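(* Let $(W,S)$ be a star reducible Coxeter group and let $w\in W$. Then at least one of the following holds: (i) $w$ is a product of (pairwise) commuting generators from $S$; (ii) there exist $s,t\in S$ with $m(s,t)\neq 2$ such that $w$ has a reduced expression beginning with $st$; (iii) there exist $s,t\in S$ with $m(s,t)\neq 2$ such that $w$ has a reduced expression ending in $ts$; (iv) there exist $s,t,u\in S$ with $m(s,t)\neq 2$, $m(t,u)\neq 2$ and $m(s,u)=2$ such that $w$ has a reduced expression beginning with $sut$.
   Context: $(W,S)$ is a Coxeter group with finite generating set $S$; $m(s,t)\in\{1,2,3,\dots,\infty\}$ is the order of $st$ (so $m(s,s)=1$); $\ell$ is the length function and $<$ the Bruhat order. A reduced expression for $w$ is a word in $S$ of minimal length representing $w$; a product is called reduced if lengths add. A product of commuting generators means a (possibly empty) product of pairwise commuting elements of $S$. An element $w\in W$ is complex if it can be written as a reduced product $x_1w_{ss'}x_2$ where $s,s'\in S$ do not commute, $m(s,s')<\infty$, and $w_{ss'}$ is the longest element of $\langle s,s'\rangle$. $W_c$ denotes the set of elements that are not complex (the fully commutative elements). Star reductions: let $I=\{s,t\}\subseteq S$ be a pair of noncommuting generators, $m=m(s,t)$ ($m=\infty$ allowed). Each $w\in W$ is uniquely $w=w_Iw^I$ with $w_I\in\langle s,t\rangle$, $\ell(sw^I)>\ell(w^I)$, $\ell(tw^I)>\ell(w^I)$, and $\ell(w)=\ell(w_I)+\ell(w^I)$. We say $y$ is left star reducible to $x$ (with respect to $I$) if $2\le \ell(y_I)<m$ and $x=ry$, where $r$ is the unique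 element of $I$ with $\ell(ry)<\ell(y)$. We say $y$ is right star reducible to $x$ if $y^{-1}$ is left star reducible to $x^{-1}$. We say $y$ is star reducible to $x$ if there is a (possibly trivial) sequence from $y$ to $x$ in which each term is left or right star reducible to the next, with respect to some pair of noncommuting generators that may vary from step to step. $W$ is star reducible if every element of $W_c$ is star reducible to a product of commuting generators from $S$. *)

theory Defs
  imports "HOL-Algebra.Algebra" "HOL-Library.Extended_Nat"
begin

definition word_prod :: "('a, 'b) monoid_scheme \<Rightarrow> 'a list \<Rightarrow> 'a" where
  "word_prod W ws = foldr (\<lambda>x y. x \<otimes>\<^bsub>W\<^esub> y) ws \<one>\<^bsub>W\<^esub>"

text \<open>
  \<^const>\<open>group.ord\<close> is \<open>0\<close> exactly on elements of infinite order; these get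
  the value \<open>\<infinity>\<close> here.
\<close>

definition cox_m :: "('a, 'b) monoid_scheme \<Rightarrow> 'a \<Rightarrow> 'a \<Rightarrow> enat" where
  "cox_m W s t =
     (let n = group.ord W (s \<otimes>\<^bsub>W\<^esub> t) in if n = 0 then \<infinity> else enat n)"

text \<open>
  Insertion of a defining relator \<open>(st)\<^sup>m\<close>, \<open>m = m(s,t) < \<infinity>\<close>,
  anywhere in a word in the alphabet \<open>S\<close>.  The case \<open>s = t\<close> gives the
  relator \<open>ss\<close>, so every letter is its own formal inverse, and words without
  inverse letters suffice: the quotient of the free monoid on \<open>S\<close> by the generated
  congruence is the group with generators \<open>S\<close> and relations
  \<open>(st)\<^sup>m = 1\<close>.
\<close>

inductive relator_insertion ::
    "('a, 'b) monoid_scheme \<Rightarrow> 'a set \<Rightarrow> 'a list \<Rightarrow> 'a list \<Rightarrow> bool"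
  for W S where
  "\<lbrakk>us \<in> lists S; vs \<in> lists S; s \<in> S; t \<in> S; cox_m W s t = enat m\<rbrakk>
     \<Longrightarrow> relator_insertion W S (us @ vs) (us @ concat (replicate m [s, t]) @ vs)"

text \<open>
  The axiom \<open>presentation\<close> says that all relations between the generators are
  consequences of the defining ones; the converse is automatic, since \<open>m(s,t)\<close> is the
  order of \<open>st\<close>.
\<close>

locale coxeter_system = group W
  for W :: "('a, 'b) monoid_scheme" (structure) +
  fixes S :: "'a set"
  assumes finite_generators: "finite S"
    and generators_subset: "S \<subseteq> carrier W"
    and generators_generate: "generate W S = carrier W"
    and generators_order: "s \<in> S \<Longrightarrow> ord s = 2"
    and presentation:
      "\<lbrakk>us \<in> lists S; vs \<in> lists S; word_prod W us = word_prod W vs\<rbrakk>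
         \<Longrightarrow> equivclp (relator_insertion W S) us vs"

definition cox_length :: "('a, 'b) monoid_scheme \<Rightarrow> 'a set \<Rightarrow> 'a \<Rightarrow> nat" where
  "cox_length W S w = (LEAST n. \<exists>ws \<in> lists S. word_prod W ws = w \<and> length ws = n)"

definition reduced_expression ::
    "('a, 'b) monoid_scheme \<Rightarrow> 'a set \<Rightarrow> 'a list \<Rightarrow> 'a \<Rightarrow> bool" where
  "reduced_expression W S ws w \<longleftrightarrow>
     ws \<in> lists S \<and> word_prod W ws = w \<and> length ws = cox_length W S w"

definition commute :: "('a, 'b) monoid_scheme \<Rightarrow> 'a \<Rightarrow> 'a \<Rightarrow> bool" where
  "commute W x y \<longleftrightarrow> x \<otimes>\<^bsub>W\<^esub> y = y \<otimes>\<^bsub>W\<^esub> x"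

definition product_of_commuting_generators ::
    "('a, 'b) monoid_scheme \<Rightarrow> 'a set \<Rightarrow> 'a \<Rightarrow> bool" where
  "product_of_commuting_generators W S w \<longleftrightarrow>
     (\<exists>ws \<in> lists S. (\<forall>s \<in> set ws. \<forall>t \<in> set ws. commute W s t) \<and> word_prod W ws = w)"

definition complex_element :: "('a, 'b) monoid_scheme \<Rightarrow> 'a set \<Rightarrow> 'a \<Rightarrow> bool" where
  "complex_element W S w \<longleftrightarrow>
     (\<exists>s \<in> S. \<exists>t \<in> S. \<exists>x1 \<in> carrier W. \<exists>x2 \<in> carrier W. \<exists>w0.
        \<not> commute W s t \<and> cox_m W s t < \<infinity> \<and>
        is_arg_max (cox_length W S) (\<lambda>v. v \<in> generate W {s, t}) w0 \<and>
        w = x1 \<otimes>\<^bsub>W\<^esub> w0 \<otimes>\<^bsub>W\<^esub> x2 \<and>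
        cox_length W S w = cox_length W S x1 + cox_length W S w0 + cox_length W S x2)"

definition W_c :: "('a, 'b) monoid_scheme \<Rightarrow> 'a set \<Rightarrow> 'a set" where
  "W_c W S = {w \<in> carrier W. \<not> complex_element W S w}"

text \<open>
  \<open>coset_decomposition W S s t w a b\<close> says that \<open>w = ab\<close> with \<open>a = w\<^sub>I\<close>,
  \<open>b = w\<^sup>I\<close> for \<open>I = {s,t}\<close>.
\<close>

definition coset_decomposition ::
    "('a, 'b) monoid_scheme \<Rightarrow> 'a set \<Rightarrow> 'a \<Rightarrow> 'a \<Rightarrow> 'a \<Rightarrow> 'a \<Rightarrow> 'a \<Rightarrow> bool" where
  "coset_decomposition W S s t w a b \<longleftrightarrow>
     a \<in> generate W {s, t} \<and> b \<in> carrier W \<and> w = a \<otimes>\<^bsub>W\<^esub> b \<and>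
     cox_length W S (s \<otimes>\<^bsub>W\<^esub> b) > cox_length W S b \<and>
     cox_length W S (t \<otimes>\<^bsub>W\<^esub> b) > cox_length W S b \<and>
     cox_length W S w = cox_length W S a + cox_length W S b"

definition left_star_reducible ::
    "('a, 'b) monoid_scheme \<Rightarrow> 'a set \<Rightarrow> 'a \<Rightarrow> 'a \<Rightarrow> bool" where
  "left_star_reducible W S y x \<longleftrightarrow>
     y \<in> carrier W \<and>
     (\<exists>s \<in> S. \<exists>t \<in> S. \<exists>a b.
        \<not> commute W s t \<and> coset_decomposition W S s t y a b \<and>
        2 \<le> cox_length W S a \<and> enat (cox_length W S a) < cox_m W s t \<and>
        (\<exists>r \<in> {s, t}. cox_length W S (r \<otimes>\<^bsub>W\<^esub> y) < cox_length W S y \<and>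
                     x = r \<otimes>\<^bsub>W\<^esub> y))"

definition right_star_reducible ::
    "('a, 'b) monoid_scheme \<Rightarrow> 'a set \<Rightarrow> 'a \<Rightarrow> 'a \<Rightarrow> bool" where
  "right_star_reducible W S y x \<longleftrightarrow>
     y \<in> carrier W \<and> x \<in> carrier W \<and>
     left_star_reducible W S (inv\<^bsub>W\<^esub> y) (inv\<^bsub>W\<^esub> x)"

definition star_reducible_to ::
    "('a, 'b) monoid_scheme \<Rightarrow> 'a set \<Rightarrow> 'a \<Rightarrow> 'a \<Rightarrow> bool" where
  "star_reducible_to W S =
     (\<lambda>y x. left_star_reducible W S y x \<or> right_star_reducible W S y x)\<^sup>*\<^sup>*"

locale star_reducible_coxeter_system = coxeter_system +
  assumes star_reducible:
    "w \<in> W_c W S \<Longrightarrow>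
       \<exists>x. product_of_commuting_generators W S x \<and> star_reducible_to W S w x"

end

(*
In a star reducible group the graph of noncommuting generators is restricted locally. A word
a b v c d with ab = ba and cd = dc, in which these two commutations are the only applicable
braid relations, has just four reduced expressions by Matsumoto's theorem; its product is then
not complex, not a product of commuting generators, and admits no star reduction, so no such
word exists.

Take a maximal prefix c of w consisting of commuting generators, and then a maximal prefix d
of the rest consisting of commuting generators, and suppose (i), (ii) and (iv) fail. A letter
r of d fails to commute with some letters of c: not with none, by maximality; not with one or
two, by the failure of (ii) and (iv); not with four or more, by a forbidden word. So there are
exactly three, all with m = 3, and the triples of distinct letters of d are disjoint. If
another letter q follows cd, then either a forbidden word occurs, or q lies in the triple of
some r and qrq = rqr yields (iv). Hence w = cd, which gives (iii).
*)
theory Submission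
  imports Defs
begin

section \<open>The exchange condition\<close>

primrec alt :: "'a \<Rightarrow> 'a \<Rightarrow> nat \<Rightarrow> 'a list" where
  "alt s t 0 = []"
| "alt s t (Suc n) = s # alt t s n"

lemma length_alt [simp]: "length (alt s t n) = n"
  by (induction n arbitrary: s t) auto

lemma Ball_set_alt [simp]:
  "(\<forall>x \<in> set (alt s t n). P x) \<longleftrightarrow> n = 0 \<or> P s \<and> (n = 1 \<or> P t)"
  by (induction n arbitrary: s t) auto

lemma relator_eq_alt: "concat (replicate m [s, t]) = alt s t (2 * m)"
  by (induction m) auto

lemma take_alt [simp]: "take i (alt s t n) = alt s t (min i n)"
proof (induction n arbitrary: i s t)
  case (Suc n)
  then show ?case by (cases i) auto
qed simp

lemma alt_add: "alt s t (n + k) = alt s t n @ (if even n then alt s t k else alt t s k)"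
  by (induction n arbitrary: s t) auto

lemma rev_alt: "rev (alt s t n) = (if even n then alt t s n else alt s t n)"
proof (induction n arbitrary: s t)
  case (Suc n)
  have "alt s t (Suc n) = alt s t n @ (if even n then [s] else [t])" for s t :: 'a
    using alt_add[of s t n 1] by simp
  then show ?case using Suc by (simp del: alt.simps(2)) simp
qed simp

lemma append2_eq_conv: "xs @ [x, y] = zs @ [x', y'] \<longleftrightarrow> xs = zs \<and> x = x' \<and> y = y'"
  using append1_eq_conv[of "xs @ [x]" y "zs @ [x']" y'] by simp

context coxeter_system
begin

section \<open>Words in the generators and the orders \<open>m(s,t)\<close>\<close>

declare in_lists_conv_set [simp] ball_Un [simp]

lemma gen_closed [simp, intro]: "s \<in> S \<Longrightarrow> s \<in> carrier W"
  using generators_subset by auto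

lemma word_prod_Nil [simp]: "word_prod W [] = \<one>"
  and word_prod_Cons [simp]: "word_prod W (s # ws) = s \<otimes> word_prod W ws"
  by (simp_all add: word_prod_def)

lemma word_prod_closed [simp, intro]: "ws \<in> lists S \<Longrightarrow> word_prod W ws \<in> carrier W"
  by (induction ws) auto

lemma word_prod_append [simp]:
  "us \<in> lists S \<Longrightarrow> vs \<in> lists S \<Longrightarrow>
     word_prod W (us @ vs) = word_prod W us \<otimes> word_prod W vs"
  by (induction us) (auto simp: m_assoc)

lemma gen_square [simp]: "s \<in> S \<Longrightarrow> s \<otimes> s = \<one>"
  using generators_order[of s] pow_ord_eq_1[of s] by (auto simp: numeral_2_eq_2)

lemma gen_inv [simp]: "s \<in> S \<Longrightarrow> inv s = s"
  by (simp add: inv_equality)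

lemma gen_cancel [simp]: "s \<in> S \<Longrightarrow> x \<in> carrier W \<Longrightarrow> s \<otimes> (s \<otimes> x) = x"
  by (simp flip: m_assoc)

lemma word_prod_rev: "ws \<in> lists S \<Longrightarrow> word_prod W (rev ws) = inv (word_prod W ws)"
  by (induction ws) (auto simp: inv_mult_group in_lists_conv_set)

lemma generate_word:
  assumes "H \<subseteq> S" "w \<in> generate W H"
  obtains ws where "ws \<in> lists H" "word_prod W ws = w"
proof -
  have "\<exists>ws \<in> lists H. word_prod W ws = w"
    using assms(2)
  proof induction
    case one
    then show ?case by (intro bexI[of _ "[]"]) auto
  next
    case (incl h)
    then show ?case using assms(1) by (intro bexI[of _ "[h]"]) auto
  next
    case (inv h)
    then show ?case using assms(1) by (intro bexI[of _ "[h]"]) auto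
  next
    case (eng x y)
    then obtain us vs where *: "us \<in> lists H" "word_prod W us = x" "vs \<in> lists H" "word_prod W vs = y"
      by blast
    then have "us \<in> lists S" "vs \<in> lists S" using lists_mono[OF assms(1)] by blast+
    with * show ?case by (intro bexI[of _ "us @ vs"]) auto
  qed
  then show thesis using that by blast
qed

lemma word_exists:
  assumes "w \<in> carrier W"
  obtains ws where "ws \<in> lists S" "word_prod W ws = w"
  using generate_word[of S w] assms generators_generate by auto

lemma cox_m_eq_enat_iff: "cox_m W s t = enat m \<longleftrightarrow> m > 0 \<and> ord (s \<otimes> t) = m"
  by (auto simp: cox_m_def Let_def)

lemma cox_m_commute: "s \<in> S \<Longrightarrow> t \<in> S \<Longrightarrow> cox_m W t s = cox_m W s t"
  using ord_inv[of "s \<otimes> t"] by (simp add: cox_m_def inv_mult_group)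

lemma pow_cox_m: "s \<in> S \<Longrightarrow> t \<in> S \<Longrightarrow> cox_m W s t = enat m \<Longrightarrow> (s \<otimes> t) [^] m = \<one>"
  by (auto simp: cox_m_eq_enat_iff)

text \<open>Infinite order is covered too: there \<open>ord\<close> is 0, and 0 divides no positive
  \<open>k\<close>.\<close>

lemma pow_less_cox_m:
  assumes "s \<in> S" "t \<in> S" "enat k < cox_m W s t" "0 < k"
  shows "(s \<otimes> t) [^] k \<noteq> \<one>"
proof
  assume "(s \<otimes> t) [^] k = \<one>"
  then have "ord (s \<otimes> t) dvd k" using assms by (simp add: pow_eq_id)
  with assms(3,4) show False
    by (auto simp: cox_m_def Let_def dest: dvd_imp_le split: if_splits)
qed

lemma commute_sym: "commute W s t \<longleftrightarrow> commute W t s"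
  by (auto simp: commute_def)

lemma commute_refl [simp]: "commute W s s"
  by (simp add: commute_def)

text \<open>\<open>(st)^2 = 1\<close> says that \<open>st\<close> equals its inverse
  \<open>ts\<close>, and \<open>st = 1\<close> says that \<open>s = t\<close>.\<close>

lemma cox_m_eq_2_iff:
  assumes "s \<in> S" "t \<in> S"
  shows "cox_m W s t = 2 \<longleftrightarrow> commute W s t \<and> s \<noteq> t"
proof -
  have "(s \<otimes> t) [^] (2::nat) = \<one> \<longleftrightarrow> s \<otimes> t = inv (s \<otimes> t)"
    using assms by (simp add: numeral_2_eq_2) (metis gen_closed inv_equality m_closed r_inv)
  then have sq: "(s \<otimes> t) [^] (2::nat) = \<one> \<longleftrightarrow> commute W s t"
    using assms by (simp add: inv_mult_group commute_def)
  have one: "s \<otimes> t = \<one> \<longleftrightarrow> s = t"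
    using assms by (metis gen_closed gen_inv gen_square inv_equality)
  have "ord (s \<otimes> t) = 2 \<longleftrightarrow> (s \<otimes> t) [^] (2::nat) = \<one> \<and> s \<otimes> t \<noteq> \<one>"
  proof
    assume "ord (s \<otimes> t) = 2"
    then show "(s \<otimes> t) [^] (2::nat) = \<one> \<and> s \<otimes> t \<noteq> \<one>"
      using assms pow_ord_eq_1[of "s \<otimes> t"] ord_eq_1[of "s \<otimes> t"] by auto
  next
    assume *: "(s \<otimes> t) [^] (2::nat) = \<one> \<and> s \<otimes> t \<noteq> \<one>"
    then have "ord (s \<otimes> t) dvd 2" "ord (s \<otimes> t) \<noteq> 1"
      using assms by (simp_all add: pow_eq_id ord_eq_1[simplified])
    then show "ord (s \<otimes> t) = 2"
      using two_is_prime_nat prime_nat_iff by blast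
  qed
  then have "ord (s \<otimes> t) = 2 \<longleftrightarrow> commute W s t \<and> s \<noteq> t" using sq one by simp
  then show ?thesis
    using cox_m_eq_enat_iff[of s t 2] by (auto simp: numeral_eq_enat)
qed

lemma cox_m_ge_3:
  assumes "s \<in> S" "t \<in> S" "\<not> commute W s t"
  shows "3 \<le> cox_m W s t"
proof (rule ccontr)
  assume "\<not> 3 \<le> cox_m W s t"
  then obtain m where m: "cox_m W s t = enat m" "m < 3"
    by (cases "cox_m W s t") (auto simp: numeral_eq_enat)
  have "m > 0" using m cox_m_eq_enat_iff by blast
  moreover have "m \<noteq> 2" using m cox_m_eq_2_iff[of s t] assms by (auto simp: numeral_eq_enat)
  moreover have "m \<noteq> 1"
  proof
    assume "m = 1"
    then have "s \<otimes> t = \<one>" using m pow_cox_m[of s t 1] assms by auto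
    then show False using assms by (metis commute_refl gen_closed gen_inv inv_equality)
  qed
  ultimately show False using m by auto
qed

text \<open>The reflections \<open>s\<^sub>1 \<dots> s\<^sub>i \<dots> s\<^sub>1\<close> attached to a word \<open>s\<^sub>1 \<dots> s\<^sub>n\<close>.\<close>

primrec refls :: "'a list \<Rightarrow> 'a list" where
  "refls [] = []"
| "refls (s # ws) = s # map (\<lambda>r. s \<otimes> r \<otimes> s) (refls ws)"

lemma refls_closed: "ws \<in> lists S \<Longrightarrow> set (refls ws) \<subseteq> carrier W"
  by (induction ws) auto

lemma refls_append:
  "us \<in> lists S \<Longrightarrow> vs \<in> lists S \<Longrightarrow>
     refls (us @ vs) =
       refls us @ map (\<lambda>r. word_prod W us \<otimes> r \<otimes> inv (word_prod W us)) (refls vs)"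
proof (induction us)
  case Nil
  then show ?case using refls_closed[of vs] by (auto intro!: map_idI[symmetric])
next
  case (Cons s us)
  have "s \<otimes> (word_prod W us \<otimes> r \<otimes> inv (word_prod W us)) \<otimes> s =
      word_prod W (s # us) \<otimes> r \<otimes> inv (word_prod W (s # us))" if "r \<in> set (refls vs)" for r
    using that Cons.prems refls_closed[of vs] by (simp add: inv_mult_group m_assoc subset_iff)
  then show ?case using Cons by simp
qed

text \<open>The \<open>i\<close>-th reflection is the palindrome \<open>sts...s\<close> of odd
  length \<open>2i+1\<close>, that is \<open>(st)^i s\<close>. The parity argument exploits its
  periodicity in \<open>i\<close>.\<close>

lemma refls_alt:
  assumes "s \<in> S" "t \<in> S"
  shows "refls (alt s t n) = map (\<lambda>i. (s \<otimes> t) [^] i \<otimes> s) [0..<n]"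
  using assms
proof (induction n arbitrary: s t)
  case 0
  then show ?case by simp
next
  case (Suc n)
  have pow: "s \<otimes> (t \<otimes> s) [^] i = (s \<otimes> t) [^] i \<otimes> s" for i :: nat
  proof (induction i)
    case (Suc i)
    have "s \<otimes> (t \<otimes> s) [^] Suc i = (s \<otimes> (t \<otimes> s) [^] i) \<otimes> (t \<otimes> s)"
      using \<open>s \<in> S\<close> \<open>t \<in> S\<close> by (simp add: m_assoc)
    also have "\<dots> = (s \<otimes> t) [^] Suc i \<otimes> s"
      unfolding Suc using \<open>s \<in> S\<close> \<open>t \<in> S\<close> by (simp add: m_assoc)
    finally show ?case .
  qed (use Suc.prems in simp)
  have "s \<otimes> ((t \<otimes> s) [^] i \<otimes> t) \<otimes> s = (s \<otimes> t) [^] Suc i \<otimes> s" for i :: nat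
  proof -
    have "s \<otimes> ((t \<otimes> s) [^] i \<otimes> t) \<otimes> s = (s \<otimes> (t \<otimes> s) [^] i) \<otimes> t \<otimes> s"
      using Suc.prems by (simp add: m_assoc)
    also have "\<dots> = (s \<otimes> t) [^] Suc i \<otimes> s"
      unfolding pow using Suc.prems by (simp add: m_assoc)
    finally show ?thesis .
  qed
  then show ?case
    using Suc by (simp add: map_upt_Suc del: upt_Suc nat_pow_Suc)
qed

lemma word_prod_alt:
  assumes "s \<in> S" "t \<in> S"
  shows "word_prod W (alt s t (2 * m)) = (s \<otimes> t) [^] m"
proof (induction m)
  case (Suc m)
  then show ?case
    using assms nat_pow_Suc2[of "s \<otimes> t" m] by (simp add: m_assoc del: nat_pow_Suc)
qed simp

lemma relator_insertionE:
  assumes "relator_insertion W S us vs"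
  obtains xs ys s t m where "xs \<in> lists S" "ys \<in> lists S" "s \<in> S" "t \<in> S"
    "us = xs @ ys" "vs = xs @ alt s t (2 * m) @ ys" "(s \<otimes> t) [^] m = \<one>"
  using assms
proof cases
  case (1 us vs s t m)
  then show thesis
    using that[of us vs s t m] pow_cox_m[of s t m] relator_eq_alt[of m s t] by simp
qed

text \<open>A relator has even length. Its reflections \<open>(st)^i s\<close> run twice through the
  same list because \<open>(st)^m = 1\<close>, so each occurs an even number of times; and since its
  product is 1, it leaves the conjugates contributed by the following letters unchanged.\<close>

lemma relator_insertion_parity:
  assumes "relator_insertion W S us vs"
  shows "even (length us) = even (length vs)"
    and "even (count_list (refls us) r) = even (count_list (refls vs) r)"
proof -
  from assms obtain xs ys s t m where
    1: "xs \<in> lists S" "ys \<in> lists S" "s \<in> S" "t \<in> S"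
       "us = xs @ ys" "vs = xs @ alt s t (2 * m) @ ys" and pow: "(s \<otimes> t) [^] m = \<one>"
    by (rule relator_insertionE)
  show "even (length us) = even (length vs)"
    using 1 by simp
  have "[0..<2 * m] = [0..<m] @ map (\<lambda>i. i + m) [0..<m]"
    using upt_add_eq_append[of 0 m m] by (simp only: map_add_upt mult_2 add_0 le0 simp_thms)
  moreover have "(s \<otimes> t) [^] (i + m) = (s \<otimes> t) [^] i" for i :: nat
    using 1 pow by (simp flip: nat_pow_mult)
  ultimately have "refls (alt s t (2 * m)) =
      map (\<lambda>i. (s \<otimes> t) [^] i \<otimes> s) [0..<m] @ map (\<lambda>i. (s \<otimes> t) [^] i \<otimes> s) [0..<m]"
    unfolding refls_alt[OF 1(3,4)] by simp
  then obtain rs where rs: "refls (alt s t (2 * m)) = rs @ rs" by blast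
  have "refls (alt s t (2 * m) @ ys) = rs @ rs @ refls ys"
    using 1(2-4) rs pow refls_closed[of ys]
    by (auto simp: refls_append word_prod_alt intro!: map_idI)
  then show "even (count_list (refls us) r) = even (count_list (refls vs) r)"
    unfolding 1(5,6) using 1(1-4)
    by (simp add: refls_append[of xs] ball_Un) blast
qed

text \<open>The presentation axiom enters the proof here: it reduces any invariant of words to a
  check on single relators.\<close>

lemma presentation_invariant:
  assumes "us \<in> lists S" "vs \<in> lists S" "word_prod W us = word_prod W vs"
    and "\<And>xs ys. relator_insertion W S xs ys \<Longrightarrow> f xs = f ys"
  shows "f us = f vs"
proof -
  have "equivclp (relator_insertion W S) us vs" using presentation assms(1-3) .
  then show ?thesis
    by (induction rule: equivclp_induct) (auto dest: assms(4))
qed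

lemma length_parity:
  assumes "us \<in> lists S" "vs \<in> lists S" "word_prod W us = word_prod W vs"
  shows "even (length us) = even (length vs)"
  using presentation_invariant[OF assms, of "\<lambda>us. even (length us)"] relator_insertion_parity(1)
  by blast

lemma refls_parity:
  assumes "us \<in> lists S" "vs \<in> lists S" "word_prod W us = word_prod W vs"
  shows "even (count_list (refls us) r) = even (count_list (refls vs) r)"
  using presentation_invariant[OF assms, of "\<lambda>us. even (count_list (refls us) r)"]
    relator_insertion_parity(2)
  by blast

text \<open>Multiplying \<open>p x q\<close> by the reflection \<open>p x p^-1\<close> cancels the
  letter \<open>x\<close>.\<close>

lemma refls_split:
  assumes "r \<in> set (refls ws)" "ws \<in> lists S"
  obtains p x q where "ws = p @ x # q" "r = word_prod W p \<otimes> x \<otimes> inv (word_prod W p)"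
    "r \<otimes> word_prod W ws = word_prod W (p @ q)"
proof -
  have "\<exists>p x q. ws = p @ x # q \<and> r = word_prod W p \<otimes> x \<otimes> inv (word_prod W p)"
    using assms
  proof (induction ws arbitrary: r)
    case (Cons s ws)
    show ?case
    proof (cases "r = s")
      case True
      then show ?thesis using Cons.prems by (intro exI[of _ "[]"]) auto
    next
      case False
      then obtain r' where r': "r' \<in> set (refls ws)" "r = s \<otimes> r' \<otimes> s"
        using Cons.prems by auto
      with Cons obtain p x q where "ws = p @ x # q" "r' = word_prod W p \<otimes> x \<otimes> inv (word_prod W p)"
        by auto blast
      then show ?thesis using Cons.prems r'
        by (intro exI[of _ "s # p"] exI[of _ x] exI[of _ q])
          (auto simp: inv_mult_group m_assoc)
    qed
  qed simp
  then obtain p x q where *: "ws = p @ x # q" "r = word_prod W p \<otimes> x \<otimes> inv (word_prod W p)"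
    by blast
  moreover have "r \<otimes> word_prod W ws = word_prod W (p @ q)"
    using * assms(2) by (simp add: m_assoc) (simp add: inv_solve_left flip: m_assoc)
  ultimately show thesis by (rule that)
qed

section \<open>Length and reduced expressions\<close>

abbreviation len :: "'a \<Rightarrow> nat" where "len \<equiv> cox_length W S"
abbreviation red :: "'a list \<Rightarrow> 'a \<Rightarrow> bool" where "red \<equiv> reduced_expression W S"

lemma redD: "red ws w \<Longrightarrow> ws \<in> lists S" "red ws w \<Longrightarrow> word_prod W ws = w"
  "red ws w \<Longrightarrow> length ws = len w"
  by (auto simp: reduced_expression_def)

lemma cox_length_le: "ws \<in> lists S \<Longrightarrow> len (word_prod W ws) \<le> length ws"
  unfolding cox_length_def by (rule Least_le) blast

lemma red_exists:
  assumes "w \<in> carrier W"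
  obtains ws where "red ws w"
proof -
  obtain us where "us \<in> lists S" "word_prod W us = w" using word_exists[OF assms] .
  then have "\<exists>n. \<exists>ws \<in> lists S. word_prod W ws = w \<and> length ws = n" by blast
  then have "\<exists>ws \<in> lists S. word_prod W ws = w \<and> length ws = len w"
    unfolding cox_length_def by (rule LeastI_ex)
  then show thesis using that by (auto simp: reduced_expression_def)
qed

lemma red_cong:
  "red us w \<Longrightarrow> vs \<in> lists S \<Longrightarrow> word_prod W vs = word_prod W us \<Longrightarrow> length vs = length us \<Longrightarrow> red vs w"
  by (auto simp: reduced_expression_def)

lemma red_if_length_le:
  "ws \<in> lists S \<Longrightarrow> word_prod W ws = w \<Longrightarrow> length ws \<le> len w \<Longrightarrow> red ws w"
  using cox_length_le[of ws] by (auto simp: reduced_expression_def)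

lemma length_gen_mult_le:
  assumes "s \<in> S" "w \<in> carrier W"
  shows "len (s \<otimes> w) \<le> Suc (len w)"
proof -
  obtain ws where "red ws w" using red_exists[OF assms(2)] .
  then show ?thesis using cox_length_le[of "s # ws"] assms redD[of ws w] by auto
qed

lemma length_le_gen_mult:
  assumes "s \<in> S" "w \<in> carrier W"
  shows "len w \<le> Suc (len (s \<otimes> w))"
  using length_gen_mult_le[of s "s \<otimes> w"] assms by simp

text \<open>The lengths of two words for one element have the same parity, so a further letter
  cannot leave the length of an element unchanged.\<close>

lemma length_gen_mult_neq:
  assumes "s \<in> S" "w \<in> carrier W"
  shows "len (s \<otimes> w) \<noteq> len w"
proof -
  obtain ws where ws: "red ws w" using red_exists[OF assms(2)] .
  obtain us where us: "red us (s \<otimes> w)" using red_exists[of "s \<otimes> w"] assms by auto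
  have "even (length (s # ws)) = even (length us)"
    using redD[OF us] redD[OF ws] assms by (intro length_parity) auto
  then show ?thesis using redD[OF us] redD[OF ws] by auto
qed

lemma red_append:
  assumes "red (us @ vs) w"
  shows "red us (word_prod W us)" "red vs (word_prod W vs)"
proof -
  have S: "us \<in> lists S" "vs \<in> lists S" and w: "word_prod W us \<otimes> word_prod W vs = w"
    and l: "length us + length vs = len w"
    using redD[OF assms] by auto
  obtain us' where us': "red us' (word_prod W us)" using red_exists S by blast
  obtain vs' where vs': "red vs' (word_prod W vs)" using red_exists S by blast
  have "len w \<le> length us' + length vs'"
    using cox_length_le[of "us' @ vs'"] redD[OF us'] redD[OF vs'] w by (simp add: ball_Un)
  moreover have "length us' \<le> length us" "length vs' \<le> length vs"
    using redD[OF us'] redD[OF vs'] cox_length_le S by auto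
  ultimately show "red us (word_prod W us)" "red vs (word_prod W vs)"
    using l S redD[OF us'] redD[OF vs'] by (auto simp: reduced_expression_def)
qed

lemma red_rev:
  assumes "red ws w"
  shows "red (rev ws) (inv w)"
proof -
  have len_inv_le: "len (inv v) \<le> len v" if "v \<in> carrier W" for v
  proof -
    obtain us where us: "red us v" using red_exists[OF \<open>v \<in> carrier W\<close>] .
    then show ?thesis
      using cox_length_le[of "rev us"] redD[OF us] word_prod_rev[of us] by (auto simp: in_lists_conv_set)
  qed
  have ws: "ws \<in> lists S" "word_prod W ws = w" "length ws = len w" using redD[OF assms] by auto
  then have "w \<in> carrier W" by auto
  then have "len w \<le> len (inv w)" using len_inv_le[of "inv w"] by simp
  then show ?thesis
    using ws word_prod_rev[of ws] by (intro red_if_length_le) (auto simp: in_lists_conv_set)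
qed

text \<open>
  In a reduced word starting with \<open>s\<close> the reflection \<open>s\<close> occurs once, so by the parity
  invariance it occurs in every word for the same element.
\<close>

lemma exchange:
  assumes "s \<in> S" "ws \<in> lists S" "len (s \<otimes> word_prod W ws) < len (word_prod W ws)"
  obtains p x q where "ws = p @ x # q" "s = word_prod W p \<otimes> x \<otimes> inv (word_prod W p)"
    "s \<otimes> word_prod W ws = word_prod W (p @ q)"
proof -
  define w where "w = word_prod W ws"
  have w: "w \<in> carrier W" using assms w_def by simp
  obtain us where us: "red us (s \<otimes> w)" using red_exists[of "s \<otimes> w"] assms w by auto
  have eq: "word_prod W (s # us) = w" using redD[OF us] assms w by auto
  \<comment> \<open>Otherwise \<open>s\<close> would delete a letter from \<open>us\<close>, and
    \<open>w\<close> would be shorter than \<open>s w\<close>.\<close>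
  have "s \<notin> set (refls us)"
  proof
    assume "s \<in> set (refls us)"
    then obtain p x q where "us = p @ x # q" "s \<otimes> word_prod W us = word_prod W (p @ q)"
      using refls_split redD[OF us] by blast
    then have "len w \<le> length us - 1"
      using cox_length_le[of "p @ q"] redD[OF us] assms(1) w by auto
    then show False using redD[OF us] assms(3) by (simp add: w_def)
  qed
  \<comment> \<open>Conjugation by \<open>s\<close> is injective and fixes \<open>s\<close>, so the
    reflections after the first in \<open>s # us\<close> also avoid \<open>s\<close>.\<close>
  moreover have "r = s" if "r \<in> set (refls us)" "s \<otimes> r \<otimes> s = s" for r
  proof -
    have r: "r \<in> carrier W" using that(1) refls_closed[of us] redD(1)[OF us] by blast
    then have "r = s \<otimes> (s \<otimes> r \<otimes> s) \<otimes> s" using assms(1) by (simp add: m_assoc)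
    then show ?thesis unfolding that(2) using assms(1) by simp
  qed
  ultimately have "s \<notin> set (map (\<lambda>r. s \<otimes> r \<otimes> s) (refls us))"
    by fastforce
  then have "count_list (refls (s # us)) s = 1" by simp
  moreover have "even (count_list (refls (s # us)) s) = even (count_list (refls ws) s)"
    using redD[OF us] assms eq w_def by (intro refls_parity) auto
  ultimately have "odd (count_list (refls ws) s)" by simp
  then have "s \<in> set (refls ws)" by (metis count_notin even_zero)
  from refls_split[OF this assms(2)] show thesis using that by blast
qed

text \<open>Letters are prepended one by one. When a new letter shortens the product, exchange lets
  it cancel a letter of the word built so far, so no foreign letters appear.\<close>

lemma red_subword:
  assumes "ws \<in> lists S"
  obtains us where "red us (word_prod W ws)" "set us \<subseteq> set ws"
proof -
  have "\<exists>us. red us (word_prod W ws) \<and> set us \<subseteq> set ws"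
    using assms
  proof (induction ws rule: list.induct)
    case Nil
    then show ?case using cox_length_le[of "[]"] by (intro exI[of _ "[]"]) (auto simp: reduced_expression_def)
  next
    case (Cons s ws)
    then obtain us where us: "red us (word_prod W ws)" "set us \<subseteq> set ws" by auto
    note us' = redD[OF us(1)]
    have sw: "s \<in> S" "word_prod W ws \<in> carrier W" using Cons.prems by auto
    show ?case
    proof (cases "len (s \<otimes> word_prod W ws) < len (word_prod W ws)")
      case False
      then have "len (word_prod W ws) < len (s \<otimes> word_prod W ws)"
        using length_gen_mult_neq[OF sw] by simp
      then have "red (s # us) (s \<otimes> word_prod W ws)"
        using us' Cons.prems by (intro red_if_length_le) auto
      then show ?thesis using us by (intro exI[of _ "s # us"]) auto
    next
      case True
      then have "len (s \<otimes> word_prod W us) < len (word_prod W us)" using us' by simp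
      from exchange[OF sw(1) us'(1) this] obtain p x q
        where *: "us = p @ x # q" "s \<otimes> word_prod W us = word_prod W (p @ q)"
        by blast
      then have "red (p @ q) (s \<otimes> word_prod W ws)"
        using us' Cons.prems length_le_gen_mult[OF sw]
        by (intro red_if_length_le) auto
      then show ?thesis using us * by (intro exI[of _ "p @ q"]) auto
    qed
  qed
  then show thesis using that by blast
qed

section \<open>Matsumoto's theorem and the word property\<close>

text \<open>\<open>alt s t m\<close> followed by the reverse, hence the inverse, of
  \<open>alt t s m\<close> is \<open>(st)^m\<close>.\<close>

lemma word_prod_alt_swap:
  assumes "s \<in> S" "t \<in> S" "cox_m W s t = enat m"
  shows "word_prod W (alt s t m) = word_prod W (alt t s m)"
proof -
  have S: "alt s t m \<in> lists S" "alt t s m \<in> lists S" using assms by auto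
  have "alt s t (2 * m) = alt s t m @ rev (alt t s m)"
    using alt_add[of s t m m] by (simp add: rev_alt mult_2)
  then have "word_prod W (alt s t m) \<otimes> inv (word_prod W (alt t s m)) = \<one>"
    using word_prod_alt[of s t m] pow_cox_m[OF assms] assms S word_prod_rev[OF S(2)]
      word_prod_append[of "alt s t m" "rev (alt t s m)"] by simp
  then show ?thesis using S by (metis inv_equality inv_inv inv_closed word_prod_closed)
qed

text \<open>
  The exchange cannot delete a letter of the alternating prefix: this would make \<open>t\<close>
  equal to \<open>(st)\<^sup>is\<close>, hence \<open>(st)\<^sup>i\<^sup>+\<^sup>1 = 1\<close>, for some \<open>i < k\<close>.
\<close>

lemma red_alt_Suc:
  assumes "s \<in> S" "t \<in> S" "red (alt s t k @ q) w" "len (t \<otimes> w) < len w" "enat k < cox_m W s t"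
  shows "\<exists>q'. red (alt t s (Suc k) @ q') w"
proof -
  define ws where "ws = alt s t k @ q"
  have ws: "ws \<in> lists S" "word_prod W ws = w" "length ws = len w"
    using redD[OF assms(3)] by (simp_all add: ws_def)
  have "len (t \<otimes> word_prod W ws) < len (word_prod W ws)" using ws assms(4) by simp
  from exchange[OF assms(2) ws(1) this] obtain p x r where
    pr: "ws = p @ x # r" "t = word_prod W p \<otimes> x \<otimes> inv (word_prod W p)"
      "t \<otimes> word_prod W ws = word_prod W (p @ r)" .
  have S: "p \<in> lists S" "x \<in> S" "r \<in> lists S" "q \<in> lists S"
    using ws(1) pr(1) redD(1)[OF assms(3)] by auto
  have "k \<le> length p"
  proof (rule ccontr)
    assume "\<not> k \<le> length p"
    moreover have "take (Suc (length p)) ws = p @ [x]" using pr(1) by simp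
    ultimately have "p @ [x] = alt s t (Suc (length p))"
      unfolding ws_def by (simp add: min_def del: alt.simps(2))
    then have "refls (p @ [x]) = map (\<lambda>i. (s \<otimes> t) [^] i \<otimes> s) [0..<Suc (length p)]"
      using refls_alt[OF assms(1,2), of "Suc (length p)"] by simp
    then have "t = (s \<otimes> t) [^] length p \<otimes> s"
      using S refls_append[of p "[x]"] pr(2) by simp
    then have "\<one> = (s \<otimes> t) [^] length p \<otimes> s \<otimes> t"
      using gen_square[OF assms(2)] by simp
    then have "(s \<otimes> t) [^] Suc (length p) = \<one>"
      using assms(1,2) by (simp add: m_assoc)
    moreover have "enat (Suc (length p)) < cox_m W s t"
      using \<open>\<not> k \<le> length p\<close> assms(5) by (metis Suc_leI enat_ord_simps(1) leD le_less_trans linorder_le_less_linear)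
    ultimately show False using pow_less_cox_m[OF assms(1,2)] by blast
  qed
  then have "take k p = alt s t k"
    using arg_cong[OF pr(1), of "take k"] by (simp add: ws_def)
  then obtain p' where p': "p = alt s t k @ p'"
    by (metis append_take_drop_id)
  have "word_prod W (t # p @ r) = w"
    using word_prod_closed[OF ws(1)] ws(2) assms(2) by (simp flip: pr(3))
  then have "red (t # p @ r) w"
    using S assms(2) ws pr(1) by (intro red_if_length_le) auto
  then show ?thesis using p' by (intro exI[of _ "p' @ r"]) simp
qed

text \<open>Each descent puts the other letter in front of an alternating prefix, so both
  alternating prefixes grow together up to length \<open>m(s,t)\<close>. They cannot exceed
  \<open>len w\<close>, which makes \<open>m(s,t)\<close> finite.\<close>

lemma red_alt_of_descents:
  assumes "s \<in> S" "t \<in> S" "w \<in> carrier W" "len (s \<otimes> w) < len w" "len (t \<otimes> w) < len w"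
  obtains m q where "cox_m W s t = enat m" "red (alt s t m @ q) w"
proof -
  have *: "enat k \<le> cox_m W s t \<Longrightarrow>
      (\<exists>q. red (alt s t k @ q) w) \<and> (\<exists>q. red (alt t s k @ q) w)" for k
  proof (induction k)
    case 0
    obtain ws where "red ws w" using red_exists[OF assms(3)] .
    then show ?case by auto
  next
    case (Suc k)
    then have "enat k < cox_m W s t" "enat k < cox_m W t s"
      using cox_m_commute[OF assms(1,2)] by (simp_all add: Suc_ile_eq)
    moreover from this(1) Suc.IH obtain q q' where "red (alt s t k @ q) w" "red (alt t s k @ q') w"
      by (auto dest: less_imp_le)
    ultimately show ?case
      using red_alt_Suc[of s t k q w] red_alt_Suc[of t s k q' w] assms by blast
  qed
  show thesis
  proof (cases "cox_m W s t")
    case (enat m)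
    then show thesis using *[of m] that by auto
  next
    case infinity
    then obtain q where "red (alt s t (Suc (len w)) @ q) w" using *[of "Suc (len w)"] by auto
    from redD(3)[OF this] show thesis by simp
  qed
qed

text \<open>Commutations are the case \<open>m = 2\<close>.\<close>

inductive braid_move :: "'a list \<Rightarrow> 'a list \<Rightarrow> bool" where
  "s \<in> S \<Longrightarrow> t \<in> S \<Longrightarrow> s \<noteq> t \<Longrightarrow> cox_m W s t = enat m \<Longrightarrow> p \<in> lists S \<Longrightarrow> q \<in> lists S \<Longrightarrow>
     braid_move (p @ alt s t m @ q) (p @ alt t s m @ q)"

lemma braid_move_append:
  assumes "braid_move us vs" "p \<in> lists S"
  shows "braid_move (p @ us) (p @ vs)"
  using assms(1)
proof cases
  case (1 s t m p' q)
  then show ?thesis using braid_move.intros[of s t m "p @ p'" q] assms(2) by auto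
qed

lemma braid_moves_append:
  assumes "braid_move\<^sup>*\<^sup>* us vs" "p \<in> lists S"
  shows "braid_move\<^sup>*\<^sup>* (p @ us) (p @ vs)"
  using assms(1)
  by induction (auto intro: rtranclp.rtrancl_into_rtrancl braid_move_append[OF _ assms(2)])

lemma red_Cons:
  assumes "red (s # ws) w"
  shows "s \<in> S" "red ws (s \<otimes> w)" "len (s \<otimes> w) < len w"
proof -
  have *: "s \<in> S" "ws \<in> lists S" "s \<otimes> word_prod W ws = w" "length (s # ws) = len w"
    using redD[OF assms] by auto
  then have "s \<otimes> w = word_prod W ws" by auto
  moreover have "red ws (word_prod W ws)" using red_append(2)[of "[s]" ws w] assms by simp
  ultimately show "s \<in> S" "red ws (s \<otimes> w)" "len (s \<otimes> w) < len w"
    using * redD(3)[of ws "s \<otimes> w"] by auto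
qed

text \<open>Equal first letters are removed by induction. Distinct first letters \<open>s\<close>,
  \<open>t\<close> are both descents of \<open>w\<close>, so there are reduced expressions beginning
  with the two sides of their braid relation; each shares its first letter with one of the given
  words and is connected to it by induction.\<close>

lemma matsumoto:
  "red us w \<Longrightarrow> red vs w \<Longrightarrow> braid_move\<^sup>*\<^sup>* us vs"
proof (induction "length us" arbitrary: us vs w)
  case 0
  then show ?case using redD(3)[of us w] redD(3)[of vs w] by simp
next
  case (Suc n)
  then have "length vs = Suc n" using redD(3)[of us w] redD(3)[of vs w] by simp
  then obtain s us' t vs' where us: "us = s # us'" and vs: "vs = t # vs'"
    using Suc(2) by (metis length_Suc_conv)
  have w: "w \<in> carrier W" using redD(1,2)[OF Suc.prems(1)] by auto
  note us' = red_Cons[OF Suc.prems(1)[unfolded us]]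
  note vs' = red_Cons[OF Suc.prems(2)[unfolded vs]]
  have n: "n = length us'" using Suc(2) us by simp
  show ?case
  proof (cases "s = t")
    case True
    then show ?thesis
      using braid_moves_append[of us' vs' "[s]"] Suc(1)[OF n us'(2)] vs' us' us vs by simp
  next
    case False
    obtain m q where m: "cox_m W s t = enat m" and q: "red (alt s t m @ q) w"
      using red_alt_of_descents[OF us'(1) vs'(1) w us'(3) vs'(3)] .
    have S: "alt s t m \<in> lists S" "alt t s m \<in> lists S" "q \<in> lists S"
      using us'(1) vs'(1) redD(1)[OF q] by auto
    have q': "red (alt t s m @ q) w"
      using red_cong[OF q, of "alt t s m @ q"] word_prod_alt_swap[OF us'(1) vs'(1) m] S by auto
    obtain k where k: "m = Suc k" using m cox_m_eq_enat_iff gr0_conv_Suc by blast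
    have "braid_move\<^sup>*\<^sup>* us' (alt t s k @ q)"
      using Suc(1)[OF n us'(2)] red_Cons(2)[of s "alt t s k @ q"] q k by simp
    then have 1: "braid_move\<^sup>*\<^sup>* us (alt s t m @ q)"
      using braid_moves_append[of _ _ "[s]"] us'(1) us k by simp
    have 2: "braid_move (alt s t m @ q) (alt t s m @ q)"
      using braid_move.intros[OF us'(1) vs'(1) False m, of "[]" q] S by simp
    have r: "red (alt s t k @ q) (t \<otimes> w)"
      using red_Cons(2)[of t "alt s t k @ q"] q' k by simp
    moreover have "n = length (alt s t k @ q)"
      using redD(3)[OF q] redD(3)[OF Suc.prems(1)] us n k by simp
    ultimately have "braid_move\<^sup>*\<^sup>* (alt s t k @ q) vs'"
      using Suc(1) vs'(2) by blast
    then have "braid_move\<^sup>*\<^sup>* (alt t s m @ q) vs"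
      using braid_moves_append[of _ _ "[t]"] vs'(1) vs k by simp
    with 1 2 show ?thesis by (meson converse_rtranclp_into_rtranclp rtranclp_trans)
  qed
qed

text \<open>If a letter shortened a reduced suffix, Matsumoto's theorem would rewrite that suffix to
  begin with the same letter, and a doubled letter would appear in a word of
  \<open>A\<close>.\<close>

lemma tits_word_property:
  assumes closed: "\<And>u v. u \<in> A \<Longrightarrow> braid_move u v \<Longrightarrow> v \<in> A"
    and double: "\<And>p x q. p @ x # x # q \<notin> A"
    and "u \<in> A" "u \<in> lists S"
  shows "red u (word_prod W u)" "red v (word_prod W u) \<Longrightarrow> v \<in> A"
proof -
  have closed': "braid_move\<^sup>*\<^sup>* u v \<Longrightarrow> u \<in> A \<Longrightarrow> v \<in> A" for u v
    by (induction rule: rtranclp_induct) (auto intro: closed)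
  \<comment> \<open>Suffixes of \<open>u\<close> are treated from right to left; the prefix
    \<open>p\<close> is carried along because membership in \<open>A\<close> concerns whole
    words.\<close>
  have "p @ v = u \<Longrightarrow> red v (word_prod W v)" for p v
  proof (induction v arbitrary: p rule: list.induct)
    case Nil
    then show ?case using cox_length_le[of "[]"] by (auto simp: reduced_expression_def)
  next
    case (Cons s v)
    then have v: "red v (word_prod W v)" using Cons.IH[of "p @ [s]"] by simp
    have S: "p \<in> lists S" "s \<in> S" "v \<in> lists S" using Cons.prems assms(4) by auto
    then have vc: "word_prod W v \<in> carrier W" by blast
    show ?case
    proof (cases "len (s \<otimes> word_prod W v) < len (word_prod W v)")
      case True
      obtain v' where v': "red v' (s \<otimes> word_prod W v)"
        using red_exists[of "s \<otimes> word_prod W v"] S vc by auto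
      have "red (s # v') (word_prod W v)"
        using redD[OF v'] S True vc by (intro red_if_length_le) auto
      then have "braid_move\<^sup>*\<^sup>* (p @ [s] @ v) (p @ [s] @ s # v')"
        using matsumoto[OF v] S braid_moves_append[of v "s # v'" "p @ [s]"] by (simp add: ball_Un)
      then have "p @ s # s # v' \<in> A" using closed' Cons.prems assms(3) by simp
      then show ?thesis using double by blast
    next
      case False
      then have "len (word_prod W v) < len (s \<otimes> word_prod W v)"
        using length_gen_mult_neq[OF S(2) vc] by simp
      then show ?thesis using S redD[OF v] by (intro red_if_length_le) auto
    qed
  qed
  then show "red u (word_prod W u)" by simp
  then show "red v (word_prod W u) \<Longrightarrow> v \<in> A"
    using matsumoto closed' assms(3) by blast
qed

section \<open>Words without star reductions\<close>

text \<open>A local test that excludes all braid relations: noncommuting neighbours exclude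
  \<open>m = 2\<close>, the bound at \<open>xyx\<close> excludes \<open>m = 3\<close>, and the ban
  on \<open>xyxy\<close> excludes every larger \<open>m\<close>.\<close>

fun rigid :: "'a list \<Rightarrow> bool" where
  "rigid (x # y # z # zs) \<longleftrightarrow>
     \<not> commute W x y \<and> (z = x \<longrightarrow> 3 < cox_m W x y \<and> (zs = [] \<or> hd zs \<noteq> y)) \<and> rigid (y # z # zs)"
| "rigid [x, y] \<longleftrightarrow> \<not> commute W x y"
| "rigid _ \<longleftrightarrow> True"

lemma rigid_Cons: "rigid (x # ws) \<Longrightarrow> rigid ws"
  by (cases ws rule: rigid.cases) auto

lemma rigid_append: "rigid (p @ ws) \<Longrightarrow> rigid ws"
  by (induction p) (auto dest: rigid_Cons)

lemma rigid_adjacent: "rigid (p @ x # y # q) \<Longrightarrow> \<not> commute W x y"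
  by (drule rigid_append) (cases q; simp)

lemma cox_m_eq_enat_neq:
  assumes "s \<in> S" "t \<in> S" "s \<noteq> t" "cox_m W s t = enat m"
  shows "2 \<le> m"
proof -
  have "m \<noteq> 1"
  proof
    assume "m = 1"
    then have "s \<otimes> t = \<one>" using pow_cox_m[OF assms(1,2,4)] assms by simp
    then show False using assms by (metis gen_closed gen_inv inv_equality)
  qed
  then show ?thesis using assms(4) cox_m_eq_enat_iff[of s t m] by simp
qed

lemma rigid_no_braid:
  assumes "rigid (p @ alt s t m @ q)" "s \<in> S" "t \<in> S" "s \<noteq> t"
  shows "cox_m W s t \<noteq> enat m"
proof
  assume m: "cox_m W s t = enat m"
  have r: "rigid (alt s t m @ q)" using rigid_append assms(1) .
  have "2 \<le> m" using cox_m_eq_enat_neq assms(2-4) m .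
  then obtain k where k: "m = Suc (Suc k)" by (metis Suc_le_D numeral_2_eq_2 Suc_le_mono)
  then have nc: "\<not> commute W s t" using r rigid_adjacent[of "[]"] by simp
  show False
  proof (cases k)
    case 0
    then show ?thesis using nc m k cox_m_eq_2_iff[of s t] assms by (simp add: numeral_eq_enat)
  next
    case (Suc j)
    then have "3 < cox_m W s t" "alt t s j @ q = [] \<or> hd (alt t s j @ q) \<noteq> t"
      using r k by auto
    then show ?thesis using m k Suc by (cases j) (auto simp: numeral_eq_enat)
  qed
qed

text \<open>
  A word \<open>abvcd\<close> in which \<open>ab = ba\<close> and \<open>cd = dc\<close> are the only applicable braid
  relations.  The first two letters block each other from starting a star reduction on
  the left, and the last two on the right.
\<close>

definition bridge :: "'a \<Rightarrow> 'a \<Rightarrow> 'a list \<Rightarrow> 'a \<Rightarrow> 'a \<Rightarrow> bool" where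
  "bridge a b v c d \<longleftrightarrow>
     {a, b, c, d} \<union> set v \<subseteq> S \<and> a \<noteq> b \<and> commute W a b \<and> c \<noteq> d \<and> commute W c d \<and> v \<noteq> [] \<and>
     (\<forall>x \<in> {a, b}. \<forall>y \<in> {c, d}. rigid (x # v @ [y]))"

text \<open>Rigidity is demanded for all four choices of end letters, which makes the notion
  symmetric in each end pair.\<close>

lemma bridge_swap:
  "bridge a b v c d \<Longrightarrow> bridge b a v c d" "bridge a b v c d \<Longrightarrow> bridge a b v d c"
  using commute_sym by (auto simp: bridge_def)

text \<open>A factor that misses both end letters lies within the rigid word
  \<open>b v c\<close>.\<close>

lemma bridge_middle:
  assumes "bridge a b v c d" "p @ u @ q = a # b # v @ [c, d]" "p \<noteq> []" "q \<noteq> []"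
  obtains p' q' where "rigid (p' @ u @ q')"
proof -
  obtain p' where p': "p = a # p'" using assms(2,3) by (cases p) auto
  obtain q' x where q': "q = q' @ [x]" using assms(4) by (cases q rule: rev_cases) auto
  have "(p' @ u @ q') @ [x] = (b # v @ [c]) @ [d]" using assms(2) p' q' by simp
  then have "p' @ u @ q' = b # v @ [c]" by blast
  then show thesis using that[of p' q'] assms(1) by (simp add: bridge_def)
qed

lemma bridge_double: "bridge a b v c d \<Longrightarrow> p @ x # x # q \<noteq> a # b # v @ [c, d]"
proof
  assume b: "bridge a b v c d" and eq: "p @ x # x # q = a # b # v @ [c, d]"
  consider "p = []" | "q = []" | "p \<noteq> []" "q \<noteq> []" by blast
  then show False
  proof cases
    case 2
    then show ?thesis
      using append2_eq_conv[of p x x "a # b # v" c d] b eq by (auto simp: bridge_def)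
  next
    case 3
    then show ?thesis
      using bridge_middle[OF b, of p "[x, x]" q] eq rigid_adjacent[of _ x x] by auto
  qed (use b eq in \<open>auto simp: bridge_def\<close>)
qed

text \<open>A braid relation away from both ends contradicts rigidity. One that touches an end
  involves the two letters of the pair there, and it is their commutation.\<close>

lemma bridge_braid:
  assumes b: "bridge a b v c d" and eq: "p @ alt s t m @ q = a # b # v @ [c, d]"
    and st: "s \<in> S" "t \<in> S" "s \<noteq> t" "cox_m W s t = enat m"
  shows "commute W s t"
    and "p @ alt t s m @ q \<in> {b # a # v @ [c, d], a # b # v @ [d, c]}"
proof -
  have "2 \<le> m" using cox_m_eq_enat_neq st .
  then obtain k where k: "m = k + 2" by (metis add.commute le_Suc_ex)
  have S: "{a, b, c, d} \<subseteq> S" and ab: "a \<noteq> b" "commute W a b" and cd: "c \<noteq> d" "commute W c d"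
    using b by (auto simp: bridge_def)
  have m2: "m = 2" if "commute W s t"
    using that st cox_m_eq_2_iff[of s t] by (simp add: numeral_eq_enat)
  consider "p = []" | "q = []" | "p \<noteq> []" "q \<noteq> []" by blast
  then have "commute W s t \<and> p @ alt t s m @ q \<in> {b # a # v @ [c, d], a # b # v @ [d, c]}"
  proof cases
    case 1
    then have "s = a" "t = b" using eq k by auto
    then show ?thesis using 1 eq ab m2 by (auto simp: numeral_2_eq_2)
  next
    case 2
    have *: "alt s t m = alt s t k @ (if even k then [s, t] else [t, s])" for s t :: 'a
      unfolding k alt_add by (simp add: numeral_2_eq_2)
    \<comment> \<open>The last two letters of \<open>alt s t m\<close> are \<open>s t\<close> or
      \<open>t s\<close> according to the parity of \<open>m\<close>, which is that of
      \<open>k\<close>.\<close>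
    define x y where "x = (if even k then s else t)" and "y = (if even k then t else s)"
    have "alt s t m = alt s t k @ [x, y]"
      using *[of s t] by (simp add: x_def y_def)
    with eq 2 have "(p @ alt s t k) @ [x, y] = (a # b # v) @ [c, d]"
      by (simp only: append_assoc append_Nil2 append_Cons)
    then have "x = c" "y = d" "p @ alt s t k = a # b # v"
      unfolding append2_eq_conv by auto
    then have "{s, t} = {c, d}" by (auto simp: x_def y_def split: if_splits)
    then have "commute W s t" using cd commute_sym by (auto simp: doubleton_eq_iff)
    then have k0: "k = 0" using m2 k by simp
    then have "s = c" "t = d" using \<open>x = c\<close> \<open>y = d\<close> by (auto simp: x_def y_def)
    moreover have "p = a # b # v" using \<open>p @ alt s t k = a # b # v\<close> k0 by simp
    moreover have "m = Suc (Suc 0)" using k k0 by simp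
    ultimately show ?thesis using 2 \<open>commute W s t\<close> by simp
  next
    case 3
    from bridge_middle[OF b eq this] obtain p' q' where "rigid (p' @ alt s t m @ q')" .
    from rigid_no_braid[OF this st(1-3)] st(4) show ?thesis by simp
  qed
  then show "commute W s t" "p @ alt t s m @ q \<in> {b # a # v @ [c, d], a # b # v @ [d, c]}"
    by auto
qed

text \<open>With \<open>v\<close> fixed, the bridge words form a set closed under braid moves and
  free of doubled letters, so the word property applies to it.\<close>

lemma bridge_reduced:
  assumes b: "bridge a b v c d"
  shows "red (a # b # v @ [c, d]) (word_prod W (a # b # v @ [c, d]))"
    and "red u (word_prod W (a # b # v @ [c, d])) \<Longrightarrow>
           \<exists>a' b' c' d'. u = a' # b' # v @ [c', d'] \<and> bridge a' b' v c' d'"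
proof -
  let ?A = "{u. \<exists>a b c d. u = a # b # v @ [c, d] \<and> bridge a b v c d}"
  have closed: "u' \<in> ?A" if "u \<in> ?A" "braid_move u u'" for u u'
    using that(2)
  proof cases
    case (1 s t m p q)
    obtain a b c d where "p @ alt s t m @ q = a # b # v @ [c, d]" and b: "bridge a b v c d"
      using \<open>u \<in> ?A\<close> 1(1) by auto
    from bridge_braid(2)[OF b this(1) 1(3-6)] show ?thesis
      using bridge_swap[OF b] 1(2) by auto
  qed
  have double: "p @ x # x # q \<notin> ?A" for p x q using bridge_double by auto
  have S: "a # b # v @ [c, d] \<in> lists S" using b by (auto simp: bridge_def)
  have A: "a # b # v @ [c, d] \<in> ?A" using b by blast
  show "red (a # b # v @ [c, d]) (word_prod W (a # b # v @ [c, d]))"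
    by (rule tits_word_property(1)[of ?A]; fact closed double A S)
  show "\<exists>a' b' c' d'. u = a' # b' # v @ [c', d'] \<and> bridge a' b' v c' d'"
    if "red u (word_prod W (a # b # v @ [c, d]))"
  proof -
    have "u \<in> ?A" by (rule tits_word_property(2)[of ?A]; fact closed double A S that)
    then show ?thesis by simp
  qed
qed

section \<open>Reduced words for complex elements and for sources of star reductions\<close>

lemma red_append_lengths:
  assumes "red us x" "red vs y" "len (x \<otimes> y) = len x + len y"
  shows "red (us @ vs) (x \<otimes> y)"
  using redD[OF assms(1)] redD[OF assms(2)] assms(3) by (auto simp: reduced_expression_def)

text \<open>A longest element of \<open>generate W {s, t}\<close> is shortened by both
  \<open>s\<close> and \<open>t\<close>, so it has a reduced expression beginning with
  \<open>alt s t m\<close>.\<close>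

lemma complex_element_factor:
  assumes "complex_element W S w"
  obtains s t m p q where "s \<in> S" "t \<in> S" "\<not> commute W s t" "cox_m W s t = enat m"
    "red (p @ alt s t m @ q) w"
proof -
  from assms obtain s t x1 x2 w0 where st: "s \<in> S" "t \<in> S" "\<not> commute W s t"
    and x: "x1 \<in> carrier W" "x2 \<in> carrier W"
    and max: "is_arg_max len (\<lambda>v. v \<in> generate W {s, t}) w0"
    and w: "w = x1 \<otimes> w0 \<otimes> x2" "len w = len x1 + len w0 + len x2"
    unfolding complex_element_def by blast
  have w0: "w0 \<in> generate W {s, t}" using max by (simp add: is_arg_max_def)
  then have w0c: "w0 \<in> carrier W" using generate_in_carrier[of "{s, t}" w0] st by auto
  have "len (r \<otimes> w0) < len w0" if "r \<in> {s, t}" for r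
  proof -
    have "r \<otimes> w0 \<in> generate W {s, t}" using generate.eng[OF generate.incl[OF that] w0] .
    then have "\<not> len w0 < len (r \<otimes> w0)" using max by (auto simp: is_arg_max_def)
    then show ?thesis using length_gen_mult_neq[of r w0] that st w0c by force
  qed
  then obtain m q where m: "cox_m W s t = enat m" and q: "red (alt s t m @ q) w0"
    using red_alt_of_descents[OF st(1,2) w0c] by blast
  obtain p where p: "red p x1" using red_exists[OF x(1)] .
  obtain r where r: "red r x2" using red_exists[OF x(2)] .
  have "red (p @ (alt s t m @ q) @ r) w"
    using redD[OF p] redD[OF q] redD[OF r] w x w0c
    by (auto simp: reduced_expression_def m_assoc)
  then show thesis using that st m by simp
qed

text \<open>The component \<open>a\<close> has a reduced word in \<open>s\<close> and
  \<open>t\<close> alone. It has at least two letters, and reducedness makes the first two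
  distinct.\<close>

lemma left_star_reducible_begins:
  assumes "left_star_reducible W S y x"
  obtains s t vs where "s \<in> S" "t \<in> S" "\<not> commute W s t" "red (s # t # vs) y"
proof -
  from assms obtain s t a b where st: "s \<in> S" "t \<in> S" "\<not> commute W s t"
    and ab: "coset_decomposition W S s t y a b" "2 \<le> len a"
    unfolding left_star_reducible_def by blast
  then have a: "a \<in> generate W {s, t}" and b: "b \<in> carrier W" and y: "y = a \<otimes> b"
    "len y = len a + len b" by (auto simp: coset_decomposition_def)
  obtain us where us: "us \<in> lists {s, t}" "word_prod W us = a"
    using generate_word[of "{s, t}" a] a st by auto
  then have "us \<in> lists S" using st by auto
  then obtain u where "red u (word_prod W us)" "set u \<subseteq> set us" by (rule red_subword)
  then have u: "red u a" "set u \<subseteq> {s, t}" using us by auto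
  obtain v where v: "red v b" using red_exists[OF b] .
  have uv: "red (u @ v) y" using red_append_lengths[OF u(1) v] y by simp
  obtain s' t' u' where u': "u = s' # t' # u'"
    using redD(3)[OF u(1)] ab(2) by (cases u rule: rigid.cases) auto
  have "s' \<noteq> t'"
  proof
    assume eq: "s' = t'"
    have "red [s', t'] (word_prod W [s', t'])"
      using red_append(1)[of "[s', t']" "u' @ v" y] uv u' by simp
    from redD(3)[OF this] redD(1)[OF this] show False
      using eq cox_length_le[of "[]"] by auto
  qed
  then have "{s', t'} = {s, t}" using u(2) u' by auto
  then have "s' \<in> S" "t' \<in> S" "\<not> commute W s' t'" using st commute_sym by (auto simp: doubleton_eq_iff)
  then show thesis using that uv u' by simp
qed

lemma right_star_reducible_ends:
  assumes "right_star_reducible W S y x"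
  obtains s t vs where "s \<in> S" "t \<in> S" "\<not> commute W s t" "red (vs @ [t, s]) y"
proof -
  have y: "y \<in> carrier W" and "left_star_reducible W S (inv y) (inv x)"
    using assms by (auto simp: right_star_reducible_def)
  then obtain s t vs where *: "s \<in> S" "t \<in> S" "\<not> commute W s t" "red (s # t # vs) (inv y)"
    using left_star_reducible_begins by blast
  then have "red (rev vs @ [t, s]) y" using red_rev[of "s # t # vs" "inv y"] y by simp
  then show thesis using that * by blast
qed

section \<open>Rearranging commuting letters in reduced words\<close>

definition commuting :: "'a list \<Rightarrow> bool" where
  "commuting us \<longleftrightarrow> (\<forall>s \<in> set us. \<forall>t \<in> set us. commute W s t)"

lemma red_replace:
  assumes "red (p @ us @ q) w" "vs \<in> lists S" "word_prod W vs = word_prod W us"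
    "length vs = length us"
  shows "red (p @ vs @ q) w"
  using assms redD(1)[OF assms(1)] by (intro red_cong[OF assms(1)]) auto

lemma word_prod_commute:
  assumes "us \<in> lists S" "x \<in> S" "\<forall>y \<in> set us. commute W x y"
  shows "word_prod W us \<otimes> x = x \<otimes> word_prod W us"
  using assms
proof (induction us rule: list.induct)
  case (Cons y us)
  then have S: "y \<in> S" "us \<in> lists S" and xy: "x \<otimes> y = y \<otimes> x" by (auto simp: commute_def)
  have "word_prod W (y # us) \<otimes> x = y \<otimes> (word_prod W us \<otimes> x)"
    using S Cons.prems by (simp add: m_assoc)
  also have "\<dots> = (y \<otimes> x) \<otimes> word_prod W us" using S Cons by (simp add: m_assoc)
  also have "\<dots> = x \<otimes> word_prod W (y # us)" using S Cons.prems by (simp add: m_assoc flip: xy)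
  finally show ?case .
qed simp

lemma red_move_right:
  assumes "red (p @ x # us @ q) w" "\<forall>y \<in> set us. commute W x y"
  shows "red (p @ us @ x # q) w"
  using red_replace[of p "x # us" q w "us @ [x]"] redD(1)[OF assms(1)]
    word_prod_commute[of us x] assms by simp

lemma red_move_left:
  assumes "red (p @ us @ x # q) w" "\<forall>y \<in> set us. commute W x y"
  shows "red (p @ x # us @ q) w"
  using red_replace[of p "us @ [x]" q w "x # us"] redD(1)[OF assms(1)]
    word_prod_commute[of us x] assms by simp

lemma word_prod_permute:
  assumes "us \<in> lists S" "commuting us" "mset us = mset vs"
  shows "word_prod W us = word_prod W vs"
  using assms
proof (induction us arbitrary: vs rule: list.induct)
  case (Cons x us)
  have set: "set vs = set (x # us)" using mset_eq_setD[OF Cons.prems(3)] by simp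
  then have "x \<in> set vs" by simp
  then obtain p q where vs: "vs = p @ x # q" by (meson split_list)
  have "\<forall>y \<in> set vs. y \<in> S" unfolding set using Cons.prems(1) by simp
  then have S: "p \<in> lists S" "x \<in> S" "q \<in> lists S" unfolding vs by simp_all
  have "\<forall>y \<in> set vs. commute W x y"
    unfolding set using Cons.prems(2) by (simp add: commuting_def)
  then have "\<forall>y \<in> set p. commute W x y" unfolding vs by simp
  then have p: "word_prod W p \<otimes> x = x \<otimes> word_prod W p" using word_prod_commute[of p x] S by simp
  have "word_prod W us = word_prod W (p @ q)"
    using Cons vs by (intro Cons.IH) (auto simp: commuting_def)
  then have "word_prod W (x # us) = (x \<otimes> word_prod W p) \<otimes> word_prod W q"
    using S by (simp add: m_assoc)
  also have "\<dots> = word_prod W vs" unfolding p[symmetric] vs using S by (simp add: m_assoc)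
  finally show ?case .
qed simp

lemma red_permute:
  assumes "red (p @ us @ q) w" "commuting us" "mset us = mset vs"
  shows "red (p @ vs @ q) w"
  using assms(1)
proof (rule red_replace)
  have us: "us \<in> lists S" using redD(1)[OF assms(1)] by simp
  then show "vs \<in> lists S" using mset_eq_setD[OF assms(3)] by simp
  show "word_prod W vs = word_prod W us" using word_prod_permute[OF us assms(2,3)] ..
  show "length vs = length us" using assms(3) mset_eq_length by metis
qed

lemma red_no_double: "\<not> red (p @ x # x # q) w"
proof
  assume *: "red (p @ x # x # q) w"
  then have S: "p \<in> lists S" "x \<in> S" "q \<in> lists S" using redD(1)[OF *] by auto
  then have "word_prod W (p @ q) = w" using redD(2)[OF *] by simp
  then have "len w \<le> length (p @ q)" using cox_length_le[of "p @ q"] S by simp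
  then show False using redD(3)[OF *] by simp
qed

text \<open>Commuting letters can be permuted until a repeated letter stands next to itself, and a
  reduced word contains no such pair.\<close>

lemma commuting_red_distinct:
  assumes "red (p @ us @ q) w" "commuting us"
  shows "distinct us"
proof (rule ccontr)
  assume "\<not> distinct us"
  then obtain xs ys zs x where us: "us = xs @ [x] @ ys @ [x] @ zs"
    using not_distinct_decomp by blast
  have "red (p @ (x # x # xs @ ys @ zs) @ q) w"
    by (rule red_permute[OF assms]) (simp add: us)
  then show False using red_no_double[of p x "xs @ ys @ zs @ q"] by simp
qed

end

section \<open>Absence of bridges in star reducible groups\<close>

context star_reducible_coxeter_system
begin

lemma no_bridge: "\<not> bridge a b v c d"
proof
  assume b: "bridge a b v c d"
  define w where "w = word_prod W (a # b # v @ [c, d])"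
  have wc: "w \<in> carrier W" using b unfolding w_def by (intro word_prod_closed) (auto simp: bridge_def)
  have red_w: "\<exists>a b c d. u = a # b # v @ [c, d] \<and> bridge a b v c d" if "red u w" for u
    using bridge_reduced(2)[OF b] that unfolding w_def .
  have "\<not> complex_element W S w"
  proof
    assume "complex_element W S w"
    then obtain s t m p q where st: "s \<in> S" "t \<in> S" "\<not> commute W s t" "cox_m W s t = enat m"
      and r: "red (p @ alt s t m @ q) w" by (rule complex_element_factor)
    obtain a b c d where "p @ alt s t m @ q = a # b # v @ [c, d]" "bridge a b v c d"
      using red_w[OF r] by blast
    from bridge_braid(1)[OF this(2,1) st(1,2) _ st(4)] st(3) show False
      using commute_refl[of s] by metis
  qed
  then obtain x where x: "product_of_commuting_generators W S x" "star_reducible_to W S w x"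
    using star_reducible wc by (auto simp: W_c_def)
  have left: "\<not> left_star_reducible W S w y" for y
  proof
    assume "left_star_reducible W S w y"
    then obtain s t vs where "\<not> commute W s t" "red (s # t # vs) w"
      by (rule left_star_reducible_begins)
    then show False using red_w[of "s # t # vs"] by (auto simp: bridge_def)
  qed
  have right: "\<not> right_star_reducible W S w y" for y
  proof
    assume "right_star_reducible W S w y"
    then obtain s t vs where st: "\<not> commute W s t" "red (vs @ [t, s]) w"
      by (rule right_star_reducible_ends)
    then obtain a b c d where "vs @ [t, s] = a # b # v @ [c, d]" and b: "bridge a b v c d"
      using red_w by blast
    then have "t = c" "s = d" using append2_eq_conv[of vs t s "a # b # v" c d] by simp_all
    then show False using st b commute_sym by (auto simp: bridge_def)
  qed
  \<comment> \<open>With no step available from \<open>w\<close>, the reduction to \<open>x\<close>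
    is trivial.\<close>
  have "x = w"
    using x(2) unfolding star_reducible_to_def
    by (rule converse_rtranclpE) (use left right in auto)
  then obtain ws where ws: "ws \<in> lists S" "\<forall>s \<in> set ws. \<forall>t \<in> set ws. commute W s t"
    "word_prod W ws = w" using x(1) by (auto simp: product_of_commuting_generators_def)
  \<comment> \<open>A reduced expression of \<open>w\<close> can be found among the commuting
    letters of \<open>ws\<close>; being a bridge, it still has two noncommuting neighbours, its
    second letter and the first letter of \<open>v\<close>.\<close>
  obtain u where u: "red u w" "set u \<subseteq> set ws" using red_subword[OF ws(1)] ws(3) by auto
  then obtain a b c d where ab: "u = a # b # v @ [c, d]" "bridge a b v c d" using red_w by blast
  then obtain x v' where v: "v = x # v'" by (cases v) (auto simp: bridge_def)
  then have "\<not> commute W b x"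
    using ab(2) rigid_adjacent[of "[]" b x "v' @ [c]"] by (simp add: bridge_def)
  then show False using ws(2) u(2) ab(1) v by auto
qed

section \<open>Commuting prefixes\<close>

lemma no_four_neighbours:
  assumes "{a, b, c, d, r} \<subseteq> S" "distinct [a, b, c, d]" "commute W a b" "commute W c d"
    "\<not> commute W a r" "\<not> commute W b r" "\<not> commute W c r" "\<not> commute W d r"
  shows False
  using no_bridge[of a b "[r]" c d] assms by (auto simp: bridge_def commute_sym[of r])

text \<open>The middle goes from \<open>r\<close> to \<open>e\<close> and back;
  \<open>m(r,e) > 3\<close> keeps \<open>rer\<close> free of braid relations. This will force the
  value 3 needed for a relation \<open>qrq = rqr\<close>.\<close>

lemma no_heavy_neighbour:
  assumes "{a, b, e, r} \<subseteq> S" "distinct [a, b, e]" "commute W a b"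
    "\<not> commute W a r" "\<not> commute W b r" "\<not> commute W e r" "3 < cox_m W r e"
  shows False
  using no_bridge[of a b "[r, e, r]" a b] assms by (auto simp: bridge_def commute_sym[of r])

text \<open>Two forks at \<open>r\<close> and \<open>r'\<close> joined through a common neighbour
  \<open>e\<close> make a bridge; this yields the disjointness of the triples.\<close>

lemma no_shared_neighbour:
  assumes "{a, b, a', b', e, r, r'} \<subseteq> S" "distinct [a, b, e]" "distinct [a', b', e]" "r \<noteq> r'"
    "commute W a b" "commute W a' b'"
    "\<not> commute W a r" "\<not> commute W b r" "\<not> commute W e r"
    "\<not> commute W a' r'" "\<not> commute W b' r'" "\<not> commute W e r'"
  shows False
  using no_bridge[of a b "[r, e, r']" a' b'] assms
  by (auto simp: bridge_def commute_sym[of r] commute_sym[of r'])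

text \<open>Used for a letter \<open>q\<close> that follows the two layers and joins two letters of
  the second.\<close>

lemma no_linked_forks:
  assumes "{a, b, a', b', q, r, r'} \<subseteq> S" "a \<noteq> b" "a' \<noteq> b'" "q \<notin> {a, b, a', b'}" "r \<noteq> r'"
    "commute W a b" "commute W a' b'"
    "\<not> commute W a r" "\<not> commute W b r" "\<not> commute W q r"
    "\<not> commute W a' r'" "\<not> commute W b' r'" "\<not> commute W q r'"
  shows False
  using no_bridge[of a b "[r, q, r']" a' b'] assms
  by (auto simp: bridge_def commute_sym[of r] commute_sym[of r'])

text \<open>The middle walks around the triangle \<open>r\<close>, \<open>q\<close>,
  \<open>e\<close> and returns to the same pair \<open>a\<close>, \<open>b\<close>.\<close>

lemma no_triangle_at_fork:
  assumes "{a, b, e, q, r} \<subseteq> S" "distinct [a, b, e, q]" "commute W a b"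
    "\<not> commute W a r" "\<not> commute W b r" "\<not> commute W e r" "\<not> commute W q r" "\<not> commute W q e"
  shows False
  using no_bridge[of a b "[r, q, e, r]" a b] assms by (auto simp: bridge_def commute_sym[of r])

section \<open>The two layers of commuting generators\<close>

lemma begins_or_ends:
  assumes w: "w \<in> carrier W"
    and not_commuting: "\<not> product_of_commuting_generators W S w"
    and not_begins: "\<And>s t vs. \<not> commute W s t \<Longrightarrow> \<not> red (s # t # vs) w"
    and not_fork: "\<And>s t u vs. \<not> commute W s t \<Longrightarrow> \<not> commute W t u \<Longrightarrow> s \<noteq> u \<Longrightarrow>
      commute W s u \<Longrightarrow> \<not> red (s # u # t # vs) w"
  obtains s t vs where "\<not> commute W s t" "red (vs @ [t, s]) w"
proof -
  \<comment> \<open>\<open>c\<close> is a longest commuting word that begins some reduced expression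
    of \<open>w\<close>; the lengths are bounded by \<open>len w\<close>.\<close>
  have "\<exists>c. (commuting c \<and> (\<exists>vs. red (c @ vs) w)) \<and>
      (\<forall>c'. commuting c' \<and> (\<exists>vs. red (c' @ vs) w) \<longrightarrow> length c' \<le> length c)"
  proof (rule ex_has_greatest_nat[of _ "[]" _ "Suc (len w)"])
    obtain ws where "red ws w" using red_exists[OF w] .
    then show "commuting [] \<and> (\<exists>vs. red ([] @ vs) w)" by (auto simp: commuting_def)
    show "\<forall>c. commuting c \<and> (\<exists>vs. red (c @ vs) w) \<longrightarrow> length c < Suc (len w)"
      by (auto dest!: redD(3))
  qed
  then obtain c us where c: "commuting c" "red (c @ us) w"
    and c_max: "\<And>c' vs. commuting c' \<Longrightarrow> red (c' @ vs) w \<Longrightarrow> length c' \<le> length c"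
    by blast
  have c_S: "set c \<subseteq> S" using redD(1)[OF c(2)] by auto
  have c_dist: "distinct c" using commuting_red_distinct[of "[]" c us w] c by simp
  \<comment> \<open>\<open>N r\<close> consists of the neighbours of \<open>r\<close> in the Coxeter
    graph that occur in \<open>c\<close>.\<close>
  define N where "N r = {s \<in> set c. \<not> commute W s r}" for r
  have N: "s \<in> S" "s \<in> set c" "\<not> commute W s r" "\<not> commute W r s" if "s \<in> N r" for s r
    using that c_S commute_sym[of s r] by (auto simp: N_def)
  have N_comm: "commute W s t" if "s \<in> N r" "t \<in> N r'" for s t r r'
    using that c(1) by (auto simp: N_def commuting_def)

  have three: "\<exists>x y z. N r = {x, y, z} \<and> distinct [x, y, z]" if red_r: "red (c @ r # vs) w" for r vs
  proof -
    have rS: "r \<in> S" using redD(1)[OF red_r] by simp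
    define A where "A = filter (\<lambda>s. \<not> commute W s r) c"
    define B where "B = filter (\<lambda>s. commute W s r) c"
    have AN: "set A = N r" and A_dist: "distinct A" using c_dist by (auto simp: A_def N_def)
    \<comment> \<open>The letters \<open>B\<close> that commute with \<open>r\<close> are moved
      behind it, so \<open>r\<close> directly follows its neighbours \<open>A\<close>. Maximality,
      (ii), (iv) and the absence of bridges then leave three as their number.\<close>
    have "red (A @ B @ r # vs) w"
      using red_permute[of "[]" c "r # vs" w "A @ B"] red_r c(1)
      by (simp add: A_def B_def mset_filter flip: multiset_partition)
    then have red_A: "red (A @ r # B @ vs) w"
      by (rule red_move_left) (auto simp: B_def commute_sym[of r])
    have "A \<noteq> []"
    proof
      assume "A = []"
      then have "\<forall>s \<in> set c. commute W s r" by (auto simp: A_def filter_empty_conv)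
      then have "commuting (c @ [r])" using c(1) commute_sym by (auto simp: commuting_def)
      from c_max[OF this, of vs] red_r show False by simp
    qed
    moreover have "A \<noteq> [s]" for s
    proof
      assume A: "A = [s]"
      then have "s \<in> N r" using AN by auto
      then show False using red_A A not_begins[of s r "B @ vs"] N(3) by simp
    qed
    moreover have "A \<noteq> [s, u]" for s u
    proof
      assume A: "A = [s, u]"
      then have "s \<in> N r" "u \<in> N r" "s \<noteq> u" using AN A_dist by auto
      then show False
        using not_fork[of s r u "B @ vs"] red_A A N(3,4) N_comm by simp
    qed
    moreover have "A \<noteq> x1 # x2 # x3 # x4 # A'" for x1 x2 x3 x4 A'
    proof
      assume A: "A = x1 # x2 # x3 # x4 # A'"
      then have "{x1, x2, x3, x4} \<subseteq> N r" using AN by auto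
      then show False
        using no_four_neighbours[of x1 x2 x3 x4 r] A A_dist N N_comm rS by auto
    qed
    ultimately obtain x y z where "A = [x, y, z]"
      by (metis neq_Nil_conv)
    then show ?thesis using AN A_dist by auto
  qed

  \<comment> \<open>\<open>c\<close> stays fixed while the second layer \<open>d\<close> is chosen
    as long as possible.\<close>
  have "\<exists>d. (commuting d \<and> (\<exists>vs. red (c @ d @ vs) w)) \<and>
      (\<forall>d'. commuting d' \<and> (\<exists>vs. red (c @ d' @ vs) w) \<longrightarrow> length d' \<le> length d)"
  proof (rule ex_has_greatest_nat[of _ "[]" _ "Suc (len w)"])
    show "commuting [] \<and> (\<exists>vs. red (c @ [] @ vs) w)" using c(2) by (auto simp: commuting_def)
    show "\<forall>d. commuting d \<and> (\<exists>vs. red (c @ d @ vs) w) \<longrightarrow> length d < Suc (len w)"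
      by (auto dest!: redD(3))
  qed
  then obtain d vs where d: "commuting d" "red (c @ d @ vs) w"
    and d_max: "\<And>d' vs. commuting d' \<Longrightarrow> red (c @ d' @ vs) w \<Longrightarrow> length d' \<le> length d"
    by blast
  have d_S: "r \<in> S" if "r \<in> set d" for r using that redD(1)[OF d(2)] by simp
  have d_dist: "distinct d" using commuting_red_distinct[of c d vs w] d by simp
  have "us \<noteq> []"
  proof
    assume "us = []"
    then have "c \<in> lists S" "word_prod W c = w" using redD(1,2)[OF c(2)] by simp_all
    then show False
      using not_commuting c(1) unfolding product_of_commuting_generators_def commuting_def by blast
  qed
  then obtain x us' where "us = x # us'" by (cases us) auto
  \<comment> \<open>A single letter is a commuting word, so the first letter after \<open>c\<close>
    bounds the length of \<open>d\<close> from below.\<close>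
  then have "d \<noteq> []" using d_max[of "[x]" us'] c(2) by (auto simp: commuting_def)
  then obtain r0 where r0: "r0 \<in> set d" by (cases d) auto

  have d_three: "\<exists>x y z. N r = {x, y, z} \<and> distinct [x, y, z]" if "r \<in> set d" for r
  proof -
    \<comment> \<open>Any letter of \<open>d\<close> can be brought directly behind
      \<open>c\<close>, where \<open>three\<close> applies.\<close>
    have "red (c @ (r # remove1 r d) @ vs) w"
      using red_permute[OF d(2) d(1), of "r # remove1 r d"] that by simp
    then show ?thesis using three[of r "remove1 r d @ vs"] by simp
  qed
  have others: "\<exists>x y. N r = {s, x, y} \<and> distinct [s, x, y]" if r: "r \<in> set d" and s: "s \<in> N r" for r s
  proof -
    obtain x y z where xyz: "N r = {x, y, z}" "distinct [x, y, z]" using d_three[OF r] by blast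
    then have "N r = {y, x, z}" "distinct [y, x, z]" "N r = {z, x, y}" "distinct [z, x, y]"
      by (auto simp: insert_commute)
    moreover have "s = x \<or> s = y \<or> s = z" using s xyz(1) by simp
    ultimately show ?thesis using xyz by blast
  qed
  have disjoint: "s \<notin> N r'" if r: "r \<in> set d" "r' \<in> set d" "r \<noteq> r'" and s: "s \<in> N r" for r r' s
  proof
    assume s': "s \<in> N r'"
    obtain a b where ab: "N r = {s, a, b}" "distinct [s, a, b]" using others r s by blast
    obtain a' b' where ab': "N r' = {s, a', b'}" "distinct [s, a', b']" using others r s' by blast
    have "{s, a, b} \<subseteq> N r" "{s, a', b'} \<subseteq> N r'" using ab ab' by auto
    then show False
      using no_shared_neighbour[of a b a' b' s r r'] ab(2) ab'(2) N N_comm r d_S by auto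
  qed
  show thesis
  proof (cases vs)
    case Nil
    \<comment> \<open>The word is \<open>c d\<close>. By disjointness \<open>s\<close> commutes with
      the letters of \<open>d\<close> other than \<open>r0\<close>, so \<open>s\<close> can leave
      \<open>c\<close> and stop right before \<open>r0\<close> at the end.\<close>
    obtain s where s: "s \<in> N r0" using d_three[OF r0] by blast
    have "red (c @ (remove1 r0 d @ [r0])) w"
      using red_permute[OF d(2) d(1), of "remove1 r0 d @ [r0]"] r0 Nil by simp
    then have "red ((remove1 s c @ [s]) @ remove1 r0 d @ [r0]) w"
      using red_permute[of "[]" c "remove1 r0 d @ [r0]" w "remove1 s c @ [s]"] c(1) N(2)[OF s] by simp
    moreover have "\<forall>y \<in> set (remove1 r0 d). commute W s y"
      using disjoint[OF r0 _ _ s] N(2)[OF s] d_dist by (auto simp: N_def)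
    ultimately have "red (remove1 s c @ remove1 r0 d @ s # [r0]) w"
      using red_move_right[of "remove1 s c" s "remove1 r0 d" "[r0]" w] by simp
    then show thesis
      using that[of r0 s "remove1 s c @ remove1 r0 d"] N(3)[OF s] commute_sym[of r0 s] by simp
  next
    case (Cons q vs')
    have qS: "q \<in> S" using redD(1)[OF d(2)] Cons by simp
    have "\<not> commuting (d @ [q])" using d_max[of "d @ [q]" vs'] d(2) Cons by auto
    then obtain r where r: "r \<in> set d" "\<not> commute W q r"
      using d(1) commute_sym commute_refl by (auto simp: commuting_def)
    have rS: "r \<in> S" using r d_S by blast
    \<comment> \<open>\<open>r\<close> is the only letter of \<open>d\<close> that blocks
      \<open>q\<close>: a second one would give two linked forks.\<close>
    have comm_q: "commute W q r'" if r': "r' \<in> set d" "r' \<noteq> r" for r'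
    proof (rule ccontr)
      assume q: "\<not> commute W q r'"
      \<comment> \<open>Otherwise \<open>q\<close> would belong to both \<open>N r\<close> and
        \<open>N r'\<close>, which are disjoint.\<close>
      have "q \<notin> set c" using disjoint[of r r' q] r r' q by (auto simp: N_def)
      obtain a b e where ab: "N r = {a, b, e}" "distinct [a, b, e]" using d_three r by blast
      obtain a' b' e' where ab': "N r' = {a', b', e'}" "distinct [a', b', e']"
        using d_three r' by blast
      have "{a, b, e} \<subseteq> N r" "{a', b', e'} \<subseteq> N r'" using ab ab' by auto
      moreover from this have "q \<notin> {a, b, a', b'}" using \<open>q \<notin> set c\<close> N(2) by blast
      ultimately show False
        using no_linked_forks[of a b a' b' q r r'] ab(2) ab'(2) N N_comm r r' q d_S qS by auto
    qed
    have False
    proof (cases "q \<in> set c")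
      case True
      \<comment> \<open>A letter \<open>q\<close> of \<open>c\<close> returns after
        \<open>d\<close>. The other two letters \<open>a\<close>, \<open>b\<close> of the triple of
        \<open>r\<close> exclude \<open>m(r,q) > 3\<close>.\<close>
      then have "q \<in> N r" using r by (simp add: N_def)
      then obtain a b where ab: "N r = {q, a, b}" "distinct [q, a, b]" using others r by blast
      then have abN: "a \<in> N r" "b \<in> N r" by auto
      have "\<not> 3 < cox_m W r q"
        using no_heavy_neighbour[of a b q r] ab(2) abN \<open>q \<in> N r\<close> N N_comm rS qS by auto
      moreover have "3 \<le> cox_m W r q" using cox_m_ge_3[OF rS qS] r commute_sym by blast
      ultimately have m: "cox_m W r q = enat 3" by (simp add: numeral_eq_enat)
      have braid: "word_prod W [r, q, r] = word_prod W [q, r, q]"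
        using word_prod_alt_swap[OF rS qS m] by (simp add: numeral_3_eq_3)
      define B where "B = filter (\<lambda>s. commute W s r) c"
      define D where "D = remove1 r d"
      have "set c = set ([a, b] @ B @ [q])" using ab(1) by (auto simp: N_def B_def)
      moreover have "distinct ([a, b] @ B @ [q])"
        using ab(2) c_dist abN \<open>q \<in> N r\<close> by (auto simp: N_def B_def)
      ultimately have c_mset: "mset c = mset ([a, b] @ B @ [q])"
        using c_dist set_eq_iff_mset_eq_distinct by blast
      \<comment> \<open>The second \<open>q\<close> passes \<open>D\<close> to form
        \<open>q r q\<close>; this becomes \<open>r q r\<close>, and its first \<open>r\<close>
        passes \<open>B\<close> to stand behind \<open>a b\<close>, which is the fork of
        (iv).\<close>
      have "red (c @ (r # D) @ q # vs') w"
        using red_permute[OF d(2) d(1), of "r # D"] r Cons by (simp add: D_def)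
      then have "red (([a, b] @ B @ [q]) @ (r # D) @ q # vs') w"
        using red_permute[of "[]" c "(r # D) @ q # vs'" w "[a, b] @ B @ [q]"] c(1) c_mset by simp
      then have "red (([a, b] @ B @ [q, r]) @ D @ q # vs') w" by simp
      then have "red (([a, b] @ B @ [q, r]) @ q # D @ vs') w"
        by (rule red_move_left) (use comm_q d_dist in \<open>auto simp: D_def\<close>)
      then have "red (([a, b] @ B) @ [q, r, q] @ D @ vs') w" by simp
      then have "red (([a, b] @ B) @ [r, q, r] @ D @ vs') w"
        by (rule red_replace) (use braid rS qS in auto)
      then have "red ([a, b] @ B @ r # [q, r] @ D @ vs') w" by simp
      then have "red ([a, b] @ r # B @ [q, r] @ D @ vs') w"
        by (rule red_move_left) (auto simp: B_def commute_sym[of r])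
      then show False
        using not_fork[of a r b "B @ [q, r] @ D @ vs'"] ab(2) abN N(3,4) N_comm by auto
    next
      case False
      then have qN: "q \<notin> N r" by (simp add: N_def)
      show False
      proof (cases "\<exists>e \<in> N r. \<not> commute W q e")
        case True
        then obtain e where e: "e \<in> N r" "\<not> commute W q e" by blast
        obtain a b where ab: "N r = {e, a, b}" "distinct [e, a, b]" using others r e by blast
        then have "a \<in> N r" "b \<in> N r" by auto
        then show False
          using no_triangle_at_fork[of a b e q r] ab(2) e N N_comm rS qS r qN by auto
      next
        case comm: False
        \<comment> \<open>\<open>q\<close> commutes with the whole triple, so it is a fourth
          neighbour of \<open>r\<close> and can be paired with \<open>e\<close>.\<close>
        obtain a b e where ab: "N r = {a, b, e}" "distinct [a, b, e]" using d_three r by blast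
        then have "a \<in> N r" "b \<in> N r" "e \<in> N r" by auto
        then show False
          using no_four_neighbours[of a b e q r] ab(2) comm commute_sym[of q e] N N_comm rS qS r qN
          by auto
      qed
    qed
    then show thesis ..
  qed
qed

end

section \<open>Return to the values \<open>m(s,t)\<close>\<close>

theorem theorem4p1:
  fixes W :: "('a, 'b) monoid_scheme" and S :: "'a set" and w :: 'a
  assumes "star_reducible_coxeter_system W S"
    and "w \<in> carrier W"
  shows
    "product_of_commuting_generators W S w
     \<or> (\<exists>s \<in> S. \<exists>t \<in> S. cox_m W s t \<noteq> 2 \<and>
          (\<exists>vs. reduced_expression W S ([s, t] @ vs) w))
     \<or> (\<exists>s \<in> S. \<exists>t \<in> S. cox_m W s t \<noteq> 2 \<and>
          (\<exists>vs. reduced_expression W S (vs @ [t, s]) w))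
     \<or> (\<exists>s \<in> S. \<exists>t \<in> S. \<exists>u \<in> S.
          cox_m W s t \<noteq> 2 \<and> cox_m W t u \<noteq> 2 \<and> cox_m W s u = 2 \<and>
          (\<exists>vs. reduced_expression W S ([s, u, t] @ vs) w))"
proof (rule ccontr)
  interpret star_reducible_coxeter_system W S by (rule assms(1))
  assume neg: "\<not> ?thesis"
  \<comment> \<open>This turns noncommuting pairs found in words into witnesses for the
    alternatives, which speak of \<open>m \<noteq> 2\<close>.\<close>
  have noncommuting: "cox_m W s t \<noteq> 2" if "s \<in> S" "t \<in> S" "\<not> commute W s t" for s t
    using cox_m_eq_2_iff that by blast
  obtain s t vs where st: "\<not> commute W s t" "red (vs @ [t, s]) w"
  proof (rule begins_or_ends[OF assms(2)])
    show "\<not> product_of_commuting_generators W S w" using neg by blast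
    show "\<not> red (s # t # vs) w" if "\<not> commute W s t" for s t vs
    proof
      assume r: "red (s # t # vs) w"
      then have "s \<in> S" "t \<in> S" using redD(1)[OF r] by auto
      then show False using neg noncommuting that r by (metis append_Cons append_Nil)
    qed
    show "\<not> red (s # u # t # vs) w"
      if "\<not> commute W s t" "\<not> commute W t u" "s \<noteq> u" "commute W s u" for s t u vs
    proof
      assume r: "red (s # u # t # vs) w"
      then have S: "s \<in> S" "u \<in> S" "t \<in> S" using redD(1)[OF r] by auto
      then have "cox_m W s u = 2" using cox_m_eq_2_iff that by blast
      then show False using neg noncommuting S that r by (metis append_Cons append_Nil)
    qed
  qed
  moreover have "s \<in> S" "t \<in> S" using redD(1)[OF st(2)] by auto
  ultimately show False using neg noncommuting by blast
qed

end
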